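(* Let $\mathfrak C = \{C_1, \ldots, C_\ell\}$ be a partition of $[p]$ with $\ell \ge 2$ and $|C_i| \leq \lceil \frac{p}{\ell} \rceil$ for all $i \in \{1,\dots,\ell\}$. Given the partial Euclidean subgradient $\widetilde \nabla^{C_{ij}} f(X) \in \mathbb{R}^{n \times p_{ij}}$, one iteration of RSSM (described in the context) requires $\mathcal O\bigl(\frac{np^2}{\ell}\bigr)$ floating point operations.
   Context: $n\ge p\ge1$ are integers, $[p]=\{1,\dots,p\}$, $\mathrm{St}(n,q)=\{X\in\mathbb{R}^{n\times q}:X^\top X=I\}$, and $\mathcal P_S$ is the nearest-point projection onto $S$ in the Frobenius norm. For $X\in\mathrm{St}(n,p)$ and distinct $i,j\in\{1,\dots,\ell\}$: $C_{ij}=C_i\cup C_j$, $p_{ij}=|C_{ij}|$; $X_{ij}$ and $X_{-ij}$ are the submatrices of $X$ formed by the columns with indices in $C_{ij}$ and in $[p]\setminus C_{ij}$; $\mathcal M_{X_{-ij}}=\{Y\in\mathrm{St}(n,p_{ij}):X_{-ij}^\top Y=0\}$; $T_{X_{ij}}\mathcal M_{X_{-ij}}=\{\xi\in\mathbb{R}^{n\times p_{ij}}:\xi^\top X_{ij}+X_{ij}^\top\xi=0,\ X_{-ij}^\top\xi=0\}$, whose orthogonal projection is $\mathcal P_{T_{X_{ij}}\mathcal M_{X_{-ij}}}(\xi)=X_{ij}\,\frac12(X_{ij}^\top\xi-\xi^\top X_{ij})+(I-XX^\top)\xi$. The objective $f:\mathbb{R}^{n\times p}\to\mathbb{R}$ is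 weakly convex and $L$-Lipschitz ($L>0$) on a bounded convex neighborhood of $\mathrm{St}(n,p)$; a partial Euclidean subgradient $\widetilde\nabla^{C_{ij}}f(X)$ is a Clarke subgradient at $X_{ij}$ of $f$ viewed as a function of the columns in $C_{ij}$ only. One iteration of RSSM from $X\in\mathrm{St}(n,p)$ with stepsize $\gamma\in(0,\frac1L)$ and a (uniformly random) unordered pair $\{i,j\}$ computes $G=\mathcal P_{T_{X_{ij}}\mathcal M_{X_{-ij}}}(\widetilde\nabla^{C_{ij}}f(X))$ and then $X^+$ with $X^+_{ij}=\mathcal P_{\mathrm{St}(n,p_{ij})}(X_{ij}-\gamma G)$, $X^+_{-ij}=X_{-ij}$. Cost convention: matrix arithmetic is counted in the standard way (the product of an $a\times b$ and a $b\times c$ matrix costs $\mathcal O(abc)$ operations), and the projection of an $n\times q$ matrix onto $\mathrm{St}(n,q)$, computed by a polar decomposition, costs $\mathcal O(nq^2)$ operations. The constant in $\mathcal O(\cdot)$ is absolute. *)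

theory Defs
  imports
    Complex_Main
    "HOL-Library.Extended_Real"
    "HOL-Library.Liminf_Limsup"
    "HOL-Library.Disjoint_Sets"
    "Jordan_Normal_Form.Matrix"
    "Jordan_Normal_Form.DL_Submatrix"
begin

text \<open>The dimensions n, p and the block sizes vary inside the statement, so \<open>n \<times> q\<close> matrices are
  elements of \<open>carrier_mat n q\<close>. Columns are numbered from 0, i.e. the index set \<open>[p]\<close> of the
  mathematical text is \<open>{0..<p}\<close>.\<close>

section \<open>Frobenius geometry, the Stiefel manifold, projections\<close>

definition fro_inner :: "real mat \<Rightarrow> real mat \<Rightarrow> real" where
  "fro_inner A B = (\<Sum>r<dim_row A. \<Sum>k<dim_col A. A $$ (r, k) * B $$ (r, k))"

definition fro_norm :: "real mat \<Rightarrow> real" where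
  "fro_norm A = sqrt (fro_inner A A)"

definition stiefel :: "nat \<Rightarrow> nat \<Rightarrow> real mat set" where
  "stiefel n q = {X \<in> carrier_mat n q. transpose_mat X * X = 1\<^sub>m q}"

text \<open>Nearest-point projection, with the convention of \<open>closest_point\<close> in \<open>HOL-Analysis\<close>. For a
  linear subspace S it is the orthogonal projection onto S.\<close>

definition fro_proj :: "real mat set \<Rightarrow> real mat \<Rightarrow> real mat" where
  "fro_proj S A = (SOME Y. Y \<in> S \<and> (\<forall>Z\<in>S. fro_norm (A - Y) \<le> fro_norm (A - Z)))"

section \<open>Column blocks\<close>

definition cols_in :: "real mat \<Rightarrow> nat set \<Rightarrow> real mat" where
  "cols_in X C = submatrix X UNIV C"

definition cols_out :: "real mat \<Rightarrow> nat set \<Rightarrow> real mat" where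
  "cols_out X C = submatrix X UNIV ({0..<dim_col X} - C)"

text \<open>Replace the columns of X with indices in C by the columns of Y; the column of Y that goes to
  index k is the one whose number is the rank of k in C.\<close>

definition set_cols :: "real mat \<Rightarrow> nat set \<Rightarrow> real mat \<Rightarrow> real mat" where
  "set_cols X C Y = mat (dim_row X) (dim_col X)
     (\<lambda>(r, k). if k \<in> C then Y $$ (r, card {a \<in> C. a < k}) else X $$ (r, k))"

text \<open>The tangent space at \<open>X\<^sub>C\<close> of the set of all Y in \<open>stiefel n (card C)\<close> that are orthogonal to
  the remaining columns of X.\<close>

definition block_tangent :: "nat \<Rightarrow> nat \<Rightarrow> nat set \<Rightarrow> real mat \<Rightarrow> real mat set" where
  "block_tangent n p C X =
     {\<xi> \<in> carrier_mat n (card C).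
        transpose_mat \<xi> * cols_in X C + transpose_mat (cols_in X C) * \<xi> = 0\<^sub>m (card C) (card C) \<and>
        transpose_mat (cols_out X C) * \<xi> = 0\<^sub>m (card ({0..<p} - C)) (card C)}"

section \<open>The objective and its partial Clarke subgradients\<close>

definition mat_convex :: "real mat set \<Rightarrow> bool" where
  "mat_convex \<Omega> \<longleftrightarrow>
     (\<forall>A\<in>\<Omega>. \<forall>B\<in>\<Omega>. \<forall>t\<in>{0..1::real}. (1 - t) \<cdot>\<^sub>m A + t \<cdot>\<^sub>m B \<in> \<Omega>)"

definition mat_convex_fun_on :: "real mat set \<Rightarrow> (real mat \<Rightarrow> real) \<Rightarrow> bool" where
  "mat_convex_fun_on \<Omega> g \<longleftrightarrow> mat_convex \<Omega> \<and>
     (\<forall>A\<in>\<Omega>. \<forall>B\<in>\<Omega>. \<forall>t\<in>{0..1::real}.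
        g ((1 - t) \<cdot>\<^sub>m A + t \<cdot>\<^sub>m B) \<le> (1 - t) * g A + t * g B)"

definition weakly_convex_on :: "real mat set \<Rightarrow> (real mat \<Rightarrow> real) \<Rightarrow> bool" where
  "weakly_convex_on \<Omega> f \<longleftrightarrow>
     (\<exists>\<rho>\<ge>0. mat_convex_fun_on \<Omega> (\<lambda>A. f A + \<rho> / 2 * (fro_norm A)\<^sup>2))"

definition mat_lipschitz_on :: "real \<Rightarrow> real mat set \<Rightarrow> (real mat \<Rightarrow> real) \<Rightarrow> bool" where
  "mat_lipschitz_on L \<Omega> f \<longleftrightarrow> (\<forall>A\<in>\<Omega>. \<forall>B\<in>\<Omega>. \<bar>f A - f B\<bar> \<le> L * fro_norm (A - B))"

definition bounded_convex_nbhd :: "nat \<Rightarrow> nat \<Rightarrow> real mat set \<Rightarrow> real mat set \<Rightarrow> bool" where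
  "bounded_convex_nbhd n p S \<Omega> \<longleftrightarrow>
     \<Omega> \<subseteq> carrier_mat n p \<and> (\<exists>b. \<forall>A\<in>\<Omega>. fro_norm A \<le> b) \<and> mat_convex \<Omega> \<and>
     (\<forall>A\<in>S. \<exists>\<epsilon>>0. \<forall>B\<in>carrier_mat n p. fro_norm (B - A) < \<epsilon> \<longrightarrow> B \<in> \<Omega>)"

definition rssm_objective :: "nat \<Rightarrow> nat \<Rightarrow> real \<Rightarrow> (real mat \<Rightarrow> real) \<Rightarrow> bool" where
  "rssm_objective n p L f \<longleftrightarrow>
     (\<exists>\<Omega>. bounded_convex_nbhd n p (stiefel n p) \<Omega> \<and> weakly_convex_on \<Omega> f \<and> mat_lipschitz_on L \<Omega> f)"

definition fro_nhds :: "nat \<Rightarrow> nat \<Rightarrow> real mat \<Rightarrow> real mat filter" where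
  "fro_nhds n q Y =
     (INF \<epsilon>\<in>{0<..}. principal {Z \<in> carrier_mat n q. fro_norm (Z - Y) < \<epsilon>})"

definition clarke_dd :: "nat \<Rightarrow> nat \<Rightarrow> (real mat \<Rightarrow> real) \<Rightarrow> real mat \<Rightarrow> real mat \<Rightarrow> ereal" where
  "clarke_dd n q g Y V =
     Limsup (fro_nhds n q Y \<times>\<^sub>F at_right 0) (\<lambda>(Z, t). ereal ((g (Z + t \<cdot>\<^sub>m V) - g Z) / t))"

definition clarke_subdiff :: "nat \<Rightarrow> nat \<Rightarrow> (real mat \<Rightarrow> real) \<Rightarrow> real mat \<Rightarrow> real mat set" where
  "clarke_subdiff n q g Y =
     {\<xi> \<in> carrier_mat n q. \<forall>V\<in>carrier_mat n q. ereal (fro_inner \<xi> V) \<le> clarke_dd n q g Y V}"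

definition partial_clarke_subdiff ::
    "nat \<Rightarrow> nat set \<Rightarrow> (real mat \<Rightarrow> real) \<Rightarrow> real mat \<Rightarrow> real mat set" where
  "partial_clarke_subdiff n C f X =
     clarke_subdiff n (card C) (\<lambda>Y. f (set_cols X C Y)) (cols_in X C)"

section \<open>One RSSM iteration for the selected pair of blocks\<close>

definition rssm_step ::
    "nat \<Rightarrow> nat \<Rightarrow> nat set \<Rightarrow> real \<Rightarrow> real mat \<Rightarrow> real mat \<Rightarrow> real mat \<Rightarrow> bool" where
  "rssm_step n p C \<gamma> X \<xi> X' \<longleftrightarrow>
     (let G = fro_proj (block_tangent n p C X) \<xi> in
      X' \<in> carrier_mat n p \<and>
      cols_in X' C = fro_proj (stiefel n (card C)) (cols_in X C - \<gamma> \<cdot>\<^sub>m G) \<and>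
      cols_out X' C = cols_out X C)"

section \<open>Matrix computations and their cost\<close>

text \<open>A computation is an expression over the three inputs of an iteration (the iterate X, the given
  partial subgradient, the stepsize) and the selected column set C. An expression does not mention
  any dimension, and its scalars are the stepsize or fixed numbers. Every occurrence of a
  subexpression is evaluated, and paid for, separately.\<close>

datatype scalar = Const real | Stepsize

datatype mexp =
    Iterate
  | Subgrad
  | Add mexp mexp
  | Sub mexp mexp
  | Mul mexp mexp
  | Scale scalar mexp
  | Transp mexp
  | GetCols mexp
  | PutCols mexp mexp
  | ProjStiefel mexp

record input =
  iterate :: "real mat"
  subgrad :: "real mat"
  stepsize :: real
  block :: "nat set"

primrec scalar_val :: "input \<Rightarrow> scalar \<Rightarrow> real" where
  "scalar_val s (Const a) = a"
| "scalar_val s Stepsize = stepsize s"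

primrec run :: "input \<Rightarrow> mexp \<Rightarrow> real mat" where
  "run s Iterate = iterate s"
| "run s Subgrad = subgrad s"
| "run s (Add a b) = run s a + run s b"
| "run s (Sub a b) = run s a - run s b"
| "run s (Mul a b) = run s a * run s b"
| "run s (Scale k a) = scalar_val s k \<cdot>\<^sub>m run s a"
| "run s (Transp a) = transpose_mat (run s a)"
| "run s (GetCols a) = cols_in (run s a) (block s)"
| "run s (PutCols a b) = set_cols (run s a) (block s) (run s b)"
| "run s (ProjStiefel a) = fro_proj (stiefel (dim_row (run s a)) (dim_col (run s a))) (run s a)"

text \<open>All operations are applied to operands of compatible dimensions.\<close>

primrec well_dim :: "input \<Rightarrow> mexp \<Rightarrow> bool" where
  "well_dim s Iterate \<longleftrightarrow> True"
| "well_dim s Subgrad \<longleftrightarrow> True"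
| "well_dim s (Add a b) \<longleftrightarrow> well_dim s a \<and> well_dim s b \<and>
     dim_row (run s a) = dim_row (run s b) \<and> dim_col (run s a) = dim_col (run s b)"
| "well_dim s (Sub a b) \<longleftrightarrow> well_dim s a \<and> well_dim s b \<and>
     dim_row (run s a) = dim_row (run s b) \<and> dim_col (run s a) = dim_col (run s b)"
| "well_dim s (Mul a b) \<longleftrightarrow> well_dim s a \<and> well_dim s b \<and>
     dim_col (run s a) = dim_row (run s b)"
| "well_dim s (Scale k a) \<longleftrightarrow> well_dim s a"
| "well_dim s (Transp a) \<longleftrightarrow> well_dim s a"
| "well_dim s (GetCols a) \<longleftrightarrow> well_dim s a \<and> block s \<subseteq> {0..<dim_col (run s a)}"
| "well_dim s (PutCols a b) \<longleftrightarrow> well_dim s a \<and> well_dim s b \<and>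
     block s \<subseteq> {0..<dim_col (run s a)} \<and>
     dim_row (run s b) = dim_row (run s a) \<and> dim_col (run s b) = card (block s)"
| "well_dim s (ProjStiefel a) \<longleftrightarrow> well_dim s a \<and> dim_col (run s a) \<le> dim_row (run s a)"

text \<open>Operation counts, as functions of the dimensions: \<open>mul_ops T a b c\<close> for the product of an
  \<open>a \<times> b\<close> and a \<open>b \<times> c\<close> matrix, \<open>ent_ops T a b\<close> for an entrywise operation (sum, difference, scalar
  multiple) with an \<open>a \<times> b\<close> result, \<open>move_ops T a b\<close> for a mere rearrangement of entries with an
  \<open>a \<times> b\<close> result, \<open>proj_ops T n q\<close> for the projection of an \<open>n \<times> q\<close> matrix onto \<open>stiefel n q\<close>.\<close>

record cost_table =
  mul_ops :: "nat \<Rightarrow> nat \<Rightarrow> nat \<Rightarrow> nat"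
  ent_ops :: "nat \<Rightarrow> nat \<Rightarrow> nat"
  move_ops :: "nat \<Rightarrow> nat \<Rightarrow> nat"
  proj_ops :: "nat \<Rightarrow> nat \<Rightarrow> nat"

text \<open>The cost convention, with \<open>\<kappa>\<close> the constant hidden in its O-bounds. Rearranging entries needs no
  floating point operation, so \<open>move_ops\<close> may be 0; a linear charge is allowed as well.\<close>

definition cost_convention :: "real \<Rightarrow> cost_table \<Rightarrow> bool" where
  "cost_convention \<kappa> T \<longleftrightarrow>
     (\<forall>a b c. real (mul_ops T a b c) \<le> \<kappa> * real (a * b * c)) \<and>
     (\<forall>a b. real (ent_ops T a b) \<le> \<kappa> * real (a * b)) \<and>
     (\<forall>a b. real (move_ops T a b) \<le> \<kappa> * real (a * b)) \<and>
     (\<forall>n q. q \<le> n \<longrightarrow> real (proj_ops T n q) \<le> \<kappa> * real (n * q\<^sup>2))"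

primrec flops :: "cost_table \<Rightarrow> input \<Rightarrow> mexp \<Rightarrow> nat" where
  "flops T s Iterate = 0"
| "flops T s Subgrad = 0"
| "flops T s (Add a b) = flops T s a + flops T s b + ent_ops T (dim_row (run s a)) (dim_col (run s a))"
| "flops T s (Sub a b) = flops T s a + flops T s b + ent_ops T (dim_row (run s a)) (dim_col (run s a))"
| "flops T s (Mul a b) = flops T s a + flops T s b +
     mul_ops T (dim_row (run s a)) (dim_col (run s a)) (dim_col (run s b))"
| "flops T s (Scale k a) = flops T s a + ent_ops T (dim_row (run s a)) (dim_col (run s a))"
| "flops T s (Transp a) = flops T s a + move_ops T (dim_col (run s a)) (dim_row (run s a))"
| "flops T s (GetCols a) = flops T s a + move_ops T (dim_row (run s a)) (card (block s))"
| "flops T s (PutCols a b) = flops T s a + flops T s b +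
     move_ops T (dim_row (run s a)) (dim_col (run s a))"
| "flops T s (ProjStiefel a) = flops T s a + proj_ops T (dim_row (run s a)) (dim_col (run s a))"

end

theory Submission
  imports Defs "HOL-Analysis.Function_Topology"
begin

text \<open>Let \<open>Y\<close> and \<open>W\<close> be the columns of \<open>X\<close> inside and outside the block, \<open>c\<close> the number of columns
  of \<open>Y\<close>. Since \<open>X X\<^sup>T = Y Y\<^sup>T + W W\<^sup>T\<close>, the tangent space projection of \<open>\<xi>\<close> is
  \<open>Y (Y\<^sup>T \<xi> - \<xi>\<^sup>T Y) / 2 + \<xi> - X (X\<^sup>T \<xi>)\<close>. Each of the boundedly many operations that evaluate it and
  finish the iteration costs \<open>O(n p c)\<close>. All \<open>l\<close> blocks are nonempty, so \<open>l \<le> p\<close>, and the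
  rounding in \<open>\<lceil>p / l\<rceil>\<close> loses at most a factor 2; hence \<open>c \<le> 4 p / l\<close>.\<close>

section \<open>The Frobenius inner product\<close>

lemma fro_inner_alt:
  "A \<in> carrier_mat n q \<Longrightarrow> fro_inner A B = (\<Sum>r<n. \<Sum>k<q. A $$ (r, k) * B $$ (r, k))"
  by (auto simp: fro_inner_def)

lemma fro_inner_commute:
  "A \<in> carrier_mat n q \<Longrightarrow> B \<in> carrier_mat n q \<Longrightarrow> fro_inner A B = fro_inner B A"
  by (simp add: fro_inner_alt[where n = n and q = q] mult.commute)

lemma fro_inner_add_left:
  "A \<in> carrier_mat n q \<Longrightarrow> B \<in> carrier_mat n q \<Longrightarrow>
    fro_inner (A + B) D = fro_inner A D + fro_inner B D"
  by (simp add: fro_inner_alt[where n = n and q = q] algebra_simps sum.distrib)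

lemma fro_inner_diff_left:
  "A \<in> carrier_mat n q \<Longrightarrow> B \<in> carrier_mat n q \<Longrightarrow>
    fro_inner (A - B) D = fro_inner A D - fro_inner B D"
  by (simp add: fro_inner_alt[where n = n and q = q] minus_carrier_mat algebra_simps sum_subtractf)

lemma fro_inner_add_right:
  "A \<in> carrier_mat n q \<Longrightarrow> B \<in> carrier_mat n q \<Longrightarrow> D \<in> carrier_mat n q \<Longrightarrow>
    fro_inner D (A + B) = fro_inner D A + fro_inner D B"
  by (simp add: fro_inner_alt[where n = n and q = q] algebra_simps sum.distrib)

lemma fro_inner_diff_right:
  "A \<in> carrier_mat n q \<Longrightarrow> B \<in> carrier_mat n q \<Longrightarrow> D \<in> carrier_mat n q \<Longrightarrow>
    fro_inner D (A - B) = fro_inner D A - fro_inner D B"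
  by (simp add: fro_inner_alt[where n = n and q = q] algebra_simps sum_subtractf)

lemma fro_inner_zero_right: "A \<in> carrier_mat n q \<Longrightarrow> fro_inner A (0\<^sub>m n q) = 0"
  by (simp add: fro_inner_alt[where n = n and q = q])

lemma fro_inner_transpose:
  assumes "A \<in> carrier_mat n q" "B \<in> carrier_mat n q"
  shows "fro_inner (transpose_mat A) (transpose_mat B) = fro_inner A B"
proof -
  have "fro_inner (transpose_mat A) (transpose_mat B) = (\<Sum>k<q. \<Sum>r<n. A $$ (r, k) * B $$ (r, k))"
    using assms by (simp add: fro_inner_alt[where n = q and q = n])
  also have "\<dots> = fro_inner A B"
    using assms by (subst sum.swap) (simp add: fro_inner_alt[where n = n and q = q])
  finally show ?thesis .
qed

text \<open>Adjointness of left multiplication: both sides are the same triple sum over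
  \<open>r\<close>, \<open>t\<close>, \<open>k\<close>, and only the order of summation
  differs.\<close>

lemma fro_inner_mult_left:
  assumes A: "A \<in> carrier_mat n m" and B: "B \<in> carrier_mat m q" and D: "D \<in> carrier_mat n q"
  shows "fro_inner (A * B) D = fro_inner B (transpose_mat A * D)"
proof -
  have AB: "A * B \<in> carrier_mat n q" using A B by simp
  have "fro_inner (A * B) D = (\<Sum>r<n. \<Sum>k<q. \<Sum>t<m. A $$ (r, t) * B $$ (t, k) * D $$ (r, k))"
    using A B by (simp add: fro_inner_alt[OF AB] scalar_prod_def sum_distrib_right atLeast0LessThan)
  also have "\<dots> = (\<Sum>k<q. \<Sum>r<n. \<Sum>t<m. A $$ (r, t) * B $$ (t, k) * D $$ (r, k))"
    by (rule sum.swap)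
  also have "\<dots> = (\<Sum>k<q. \<Sum>t<m. \<Sum>r<n. A $$ (r, t) * B $$ (t, k) * D $$ (r, k))"
    by (intro sum.cong refl sum.swap)
  also have "\<dots> = (\<Sum>t<m. \<Sum>k<q. \<Sum>r<n. A $$ (r, t) * B $$ (t, k) * D $$ (r, k))"
    by (rule sum.swap)
  also have "\<dots> = fro_inner B (transpose_mat A * D)"
    using A D by (simp add: fro_inner_alt[OF B] scalar_prod_def sum_distrib_left atLeast0LessThan mult.assoc
        mult.left_commute)
  finally show ?thesis .
qed

text \<open>Transposing both arguments preserves the inner product, so pairing \<open>P\<close> with
  \<open>Q\<^sup>T\<close> or with \<open>Q\<close> gives the same value; the two values add up to
  the pairing with the zero matrix.\<close>

lemma fro_inner_symmetric_skew:
  assumes P: "P \<in> carrier_mat q q" and Q: "Q \<in> carrier_mat q q"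
    and sym: "transpose_mat P = P" and skew: "transpose_mat Q + Q = 0\<^sub>m q q"
  shows "fro_inner P Q = 0"
proof -
  have tQ: "transpose_mat Q \<in> carrier_mat q q" using Q by simp
  have "0 = fro_inner (transpose_mat Q + Q) P"
    unfolding skew using P by (simp add: fro_inner_alt[where n = q and q = q])
  also have "\<dots> = fro_inner (transpose_mat Q) (transpose_mat P) + fro_inner Q P"
    by (simp add: fro_inner_add_left[OF tQ Q] sym)
  also have "\<dots> = 2 * fro_inner P Q"
    using fro_inner_transpose[OF Q P] fro_inner_commute[OF P Q] by simp
  finally show ?thesis by simp
qed

lemma fro_inner_self_nonneg: "0 \<le> fro_inner A A"
  by (simp add: fro_inner_def sum_nonneg)

lemma fro_inner_self_eq_0:
  assumes "A \<in> carrier_mat n q" "fro_inner A A = 0"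
  shows "A = 0\<^sub>m n q"
  using assms
  by (auto simp: fro_inner_alt[where n = n and q = q] sum_nonneg_eq_0_iff sum_nonneg)

section \<open>Nearest points\<close>

text \<open>By \<open>orth\<close> the cross term of \<open>(A - P) + (P - Z)\<close> vanishes, so
  the squared distance from \<open>A\<close> to \<open>Z\<close> exceeds that to \<open>P\<close> by
  exactly the squared norm of \<open>P - Z\<close>. This yields minimality and also uniqueness,
  which is what pins down the choice operator in \<open>fro_proj\<close>.\<close>

lemma fro_proj_eqI:
  assumes S: "S \<subseteq> carrier_mat n q" and A: "A \<in> carrier_mat n q" and P: "P \<in> S"
    and orth: "\<And>Z. Z \<in> S \<Longrightarrow> fro_inner (A - P) (P - Z) = 0"
  shows "fro_proj S A = P"
proof -
  have pyth: "fro_inner (A - Z) (A - Z) = fro_inner (A - P) (A - P) + fro_inner (P - Z) (P - Z)"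
    if Z: "Z \<in> S" for Z
  proof -
    have cP: "P \<in> carrier_mat n q" and cZ: "Z \<in> carrier_mat n q" using S P Z by auto
    have c: "A - P \<in> carrier_mat n q" "P - Z \<in> carrier_mat n q"
      using cP cZ by (auto simp: minus_carrier_mat)
    have split: "A - Z = (A - P) + (P - Z)"
      using A cP cZ by (intro eq_matI) auto
    have "fro_inner (A - Z) (A - Z) =
        (fro_inner (A - P) (A - P) + fro_inner (A - P) (P - Z))
        + (fro_inner (P - Z) (A - P) + fro_inner (P - Z) (P - Z))"
      unfolding split fro_inner_add_left[OF c] fro_inner_add_right[OF c c(1)]
        fro_inner_add_right[OF c c(2)] by (rule refl)
    also have "fro_inner (P - Z) (A - P) = fro_inner (A - P) (P - Z)"
      using c by (intro fro_inner_commute)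
    finally show ?thesis using orth[OF Z] by simp
  qed
  show ?thesis unfolding fro_proj_def
  proof (rule some_equality)
    show "P \<in> S \<and> (\<forall>Z\<in>S. fro_norm (A - P) \<le> fro_norm (A - Z))"
    proof (intro conjI ballI P)
      fix Z assume "Z \<in> S"
      from pyth[OF this] show "fro_norm (A - P) \<le> fro_norm (A - Z)"
        using fro_inner_self_nonneg[of "P - Z"] unfolding fro_norm_def by simp
    qed
  next
    fix Y assume Y: "Y \<in> S \<and> (\<forall>Z\<in>S. fro_norm (A - Y) \<le> fro_norm (A - Z))"
    then have "fro_inner (A - Y) (A - Y) \<le> fro_inner (A - P) (A - P)"
      using P by (auto simp: fro_norm_def)
    moreover have "fro_inner (A - Y) (A - Y) =
        fro_inner (A - P) (A - P) + fro_inner (P - Y) (P - Y)"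
      using Y by (intro pyth) simp
    ultimately have z0: "fro_inner (P - Y) (P - Y) = 0"
      using fro_inner_self_nonneg[of "P - Y"] by linarith
    have cP: "P \<in> carrier_mat n q" and cY: "Y \<in> carrier_mat n q" using S P Y by auto
    then have z: "P - Y = 0\<^sub>m n q"
      using z0 by (intro fro_inner_self_eq_0) (simp_all add: minus_carrier_mat)
    have "Y $$ (r, k) = P $$ (r, k)" if "r < n" "k < q" for r k
      using arg_cong[OF z, of "\<lambda>M. M $$ (r, k)"] cP cY that by simp
    then show "Y = P" using cP cY by (intro eq_matI) simp_all
  qed
qed

section \<open>Existence of nearest points on the Stiefel manifold\<close>

lemma stiefel_gram:
  assumes "M \<in> carrier_mat n q"
  shows "M \<in> stiefel n q \<longleftrightarrow>
    (\<forall>a<q. \<forall>b<q. (\<Sum>r<n. M $$ (r, a) * M $$ (r, b)) = (if a = b then 1 else 0))"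
proof -
  have entry: "(transpose_mat M * M) $$ (a, b) = (\<Sum>r<n. M $$ (r, a) * M $$ (r, b))"
    if "a < q" "b < q" for a b
    using assms that by (simp add: scalar_prod_def atLeast0LessThan)
  have "transpose_mat M * M = 1\<^sub>m q \<longleftrightarrow>
      (\<forall>a<q. \<forall>b<q. (transpose_mat M * M) $$ (a, b) = 1\<^sub>m q $$ (a, b))"
    using assms by (simp only: mat_eq_iff) simp
  then show ?thesis
    using assms by (simp add: stiefel_def entry del: index_mult_mat(1))
qed

text \<open>The projection onto the Stiefel manifold exists because the manifold is compact. Matrices do not
  form a topological space here, so compactness is obtained for their entry functions.\<close>

lemma fro_proj_stiefel:
  assumes A: "A \<in> carrier_mat n q" and ne: "stiefel n q \<noteq> {}"
  shows "fro_proj (stiefel n q) A \<in> stiefel n q"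
proof -
  \<comment> \<open>Index pairs outside the matrix are pinned to 0, so \<open>B\<close> is a product
    of compact sets over all pairs and is compact by Tychonoff.\<close>
  define B :: "(nat \<times> nat \<Rightarrow> real) set"
    where "B = PiE UNIV (\<lambda>x. if fst x < n \<and> snd x < q then {-1..1} else {0})"
  \<comment> \<open>The orthonormality equations, each between continuous functions of the entries;
    hence \<open>Q\<close> is closed.\<close>
  define Q where "Q = (\<Inter>a\<in>{..<q}. \<Inter>b\<in>{..<q}.
    {g :: nat \<times> nat \<Rightarrow> real. (\<Sum>r<n. g (r, a) * g (r, b)) = (if a = b then 1 else 0)})"
  have "compactin (product_topology (\<lambda>_. euclidean) UNIV) B"
    unfolding B_def compactin_PiE by auto
  then have cB: "compact B" by (simp add: euclidean_product_topology)
  have cont: "continuous_on UNIV (\<lambda>g :: nat \<times> nat \<Rightarrow> real. g x)" for x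
    by simp
  have "closed Q" unfolding Q_def
    by (intro closed_INT ballI closed_Collect_eq continuous_intros cont)
  with cB have cBQ: "compact (B \<inter> Q)" by (rule compact_Int_closed)
  have in_Q: "mat n q g \<in> stiefel n q \<longleftrightarrow> g \<in> Q" for g
    by (subst stiefel_gram[where n = n and q = q]) (auto simp: Q_def)
  have surj: "\<exists>g\<in>B \<inter> Q. M = mat n q g" if M: "M \<in> stiefel n q" for M
  proof -
    define g where "g = (\<lambda>x. if fst x < n \<and> snd x < q then M $$ x else 0)"
    have cM: "M \<in> carrier_mat n q" using M by (simp add: stiefel_def)
    have Mg: "M = mat n q g" using cM by (intro eq_matI) (auto simp: g_def)
    \<comment> \<open>A squared entry is one summand of the squared length of its column, which is
      1.\<close>
    have "\<bar>M $$ (r, k)\<bar> \<le> 1" if "r < n" "k < q" for r k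
    proof -
      have "(M $$ (r, k))\<^sup>2 \<le> (\<Sum>r<n. (M $$ (r, k))\<^sup>2)"
        using that by (intro member_le_sum) auto
      also have "\<dots> = 1"
        using M that unfolding stiefel_gram[OF cM] by (auto simp: power2_eq_square)
      finally show ?thesis by (simp add: abs_square_le_1)
    qed
    then have "g \<in> B" by (auto simp: B_def g_def abs_le_iff minus_le_iff)
    moreover have "g \<in> Q" using M Mg in_Q by metis
    ultimately show ?thesis using Mg by blast
  qed
  have dist: "fro_norm (A - mat n q g) = sqrt (\<Sum>r<n. \<Sum>k<q. (A $$ (r, k) - g (r, k))\<^sup>2)" for g
    using A by (simp add: fro_norm_def fro_inner_alt[where n = n and q = q] minus_carrier_mat
        power2_eq_square)
  have "continuous_on (B \<inter> Q) (\<lambda>g. fro_norm (A - mat n q g))"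
    unfolding dist by (intro continuous_intros continuous_on_subset[OF cont]) auto
  moreover have "B \<inter> Q \<noteq> {}" using ne surj by blast
  ultimately obtain g where g: "g \<in> B \<inter> Q"
    and min: "\<And>h. h \<in> B \<inter> Q \<Longrightarrow> fro_norm (A - mat n q g) \<le> fro_norm (A - mat n q h)"
    using continuous_attains_inf[OF cBQ] by blast
  have "\<exists>Y. Y \<in> stiefel n q \<and> (\<forall>Z\<in>stiefel n q. fro_norm (A - Y) \<le> fro_norm (A - Z))"
    using g in_Q min surj by (metis IntD2)
  then show ?thesis unfolding fro_proj_def by (rule someI2_ex) simp
qed

section \<open>Column blocks\<close>

text \<open>The rank within \<open>C\<close> inverts \<open>pick C\<close>. This reindexes sums over
  column positions as sums over \<open>C\<close>, and shows that distinct positions hold distinct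
  columns of \<open>X\<close>.\<close>

lemma bij_betw_pick: "finite C \<Longrightarrow> bij_betw (pick C) {..<card C} C"
  by (rule bij_betw_byWitness[where f' = "\<lambda>i. card {a \<in> C. a < i}"])
    (auto simp: card_pick pick_card_in_set pick_in_set intro!: psubset_card_mono)

lemma cols_in_eq:
  assumes "X \<in> carrier_mat n p" "C \<subseteq> {0..<p}"
  shows "cols_in X C = mat n (card C) (\<lambda>(r, k). X $$ (r, pick C k))"
proof -
  have "{j. j < p \<and> j \<in> C} = C" using assms by auto
  then show ?thesis using assms by (auto simp: cols_in_def submatrix_def pick_UNIV)
qed

lemma cols_in_carrier:
  "X \<in> carrier_mat n p \<Longrightarrow> C \<subseteq> {0..<p} \<Longrightarrow> cols_in X C \<in> carrier_mat n (card C)"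
  by (simp add: cols_in_eq)

lemma cols_out_eq: "X \<in> carrier_mat n p \<Longrightarrow> cols_out X C = cols_in X ({0..<p} - C)"
  by (auto simp: cols_out_def cols_in_def)

lemma pick_in: "C \<subseteq> {0..<p} \<Longrightarrow> k < card C \<Longrightarrow> pick C k \<in> C \<and> pick C k < p"
  using pick_in_set_le by fastforce

lemma set_cols_carrier: "X \<in> carrier_mat n p \<Longrightarrow> set_cols X C Y \<in> carrier_mat n p"
  by (auto simp: set_cols_def)

text \<open>Insertion places columns by rank and extraction reads them by \<open>pick\<close>; the
  rank of \<open>pick C k\<close> is \<open>k\<close>, so the two cancel.\<close>

lemma cols_in_set_cols:
  assumes X: "X \<in> carrier_mat n p" and C: "C \<subseteq> {0..<p}" and Y: "Y \<in> carrier_mat n (card C)"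
  shows "cols_in (set_cols X C Y) C = Y"
  unfolding cols_in_eq[OF set_cols_carrier[OF X] C]
  using X Y pick_in[OF C] by (intro eq_matI) (auto simp: set_cols_def card_pick)

lemma cols_out_set_cols:
  assumes X: "X \<in> carrier_mat n p" and C: "C \<subseteq> {0..<p}"
  shows "cols_out (set_cols X C Y) C = cols_out X C"
proof -
  have D: "{0..<p} - C \<subseteq> {0..<p}" by auto
  show ?thesis
    unfolding cols_out_eq[OF X] cols_out_eq[OF set_cols_carrier[OF X]]
      cols_in_eq[OF X D] cols_in_eq[OF set_cols_carrier[OF X] D]
    using X pick_in[OF D] by (intro eq_matI) (auto simp: set_cols_def)
qed

text \<open>Common source of two relations: for \<open>D = C\<close> injectivity of
  \<open>pick\<close> turns the condition into \<open>a = b\<close>, and for disjoint blocks the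
  condition never holds.\<close>

lemma gram_cols_in:
  assumes X: "X \<in> stiefel n p" and C: "C \<subseteq> {0..<p}" and D: "D \<subseteq> {0..<p}"
    and a: "a < card C" and b: "b < card D"
  shows "(transpose_mat (cols_in X C) * cols_in X D) $$ (a, b) = (if pick C a = pick D b then 1 else 0)"
proof -
  have cX: "X \<in> carrier_mat n p" using X by (simp add: stiefel_def)
  have "(\<Sum>r<n. X $$ (r, pick C a) * X $$ (r, pick D b)) = (if pick C a = pick D b then 1 else 0)"
    using X pick_in[OF C a] pick_in[OF D b] unfolding stiefel_gram[OF cX] by blast
  then show ?thesis
    using a b by (simp add: cols_in_eq[OF cX C] cols_in_eq[OF cX D] scalar_prod_def atLeast0LessThan)
qed

lemma cols_in_stiefel:
  assumes X: "X \<in> stiefel n p" and C: "C \<subseteq> {0..<p}"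
  shows "cols_in X C \<in> stiefel n (card C)"
proof -
  have cX: "X \<in> carrier_mat n p" using X by (simp add: stiefel_def)
  have fin: "finite C" using C finite_subset by blast
  have "transpose_mat (cols_in X C) * cols_in X C = 1\<^sub>m (card C)"
    using cols_in_carrier[OF cX C] bij_betw_imp_inj_on[OF bij_betw_pick[OF fin]]
    by (intro eq_matI) (auto simp del: index_mult_mat(1) simp: gram_cols_in[OF X C C] inj_on_eq_iff)
  then show ?thesis using cols_in_carrier[OF cX C] by (simp add: stiefel_def)
qed

lemma gram_cols_in_disjoint:
  assumes X: "X \<in> stiefel n p" and C: "C \<subseteq> {0..<p}" and D: "D \<subseteq> {0..<p}" and CD: "C \<inter> D = {}"
  shows "transpose_mat (cols_in X C) * cols_in X D = 0\<^sub>m (card C) (card D)"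
proof -
  have cX: "X \<in> carrier_mat n p" using X by (simp add: stiefel_def)
  have "pick C a \<noteq> pick D b" if "a < card C" "b < card D" for a b
    using pick_in[OF C that(1)] pick_in[OF D that(2)] CD by auto
  then show ?thesis
    using cols_in_carrier[OF cX C] cols_in_carrier[OF cX D]
    by (intro eq_matI) (auto simp del: index_mult_mat(1) simp: gram_cols_in[OF X C D])
qed

text \<open>An entry of an outer product is a sum over column indices, and this sum over
  \<open>{0..<p}\<close> splits into the sums over \<open>C\<close> and over its complement.\<close>

lemma cols_in_outer_sum:
  assumes X: "X \<in> carrier_mat n p" and C: "C \<subseteq> {0..<p}"
  shows "cols_in X C * transpose_mat (cols_in X C) + cols_out X C * transpose_mat (cols_out X C)
    = X * transpose_mat X"
proof -
  let ?D = "{0..<p} - C"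
  have D: "?D \<subseteq> {0..<p}" by auto
  have outer: "(cols_in X E * transpose_mat (cols_in X E)) $$ (r, s) = (\<Sum>m\<in>E. X $$ (r, m) * X $$ (s, m))"
    if E: "E \<subseteq> {0..<p}" and rs: "r < n" "s < n" for E r s
  proof -
    have "(cols_in X E * transpose_mat (cols_in X E)) $$ (r, s)
        = (\<Sum>k<card E. X $$ (r, pick E k) * X $$ (s, pick E k))"
      using rs by (simp add: cols_in_eq[OF X E] scalar_prod_def atLeast0LessThan)
    also have "\<dots> = (\<Sum>m\<in>E. X $$ (r, m) * X $$ (s, m))"
      using bij_betw_pick[of E] E finite_subset by (intro sum.reindex_bij_betw) blast
    finally show ?thesis .
  qed
  show ?thesis
  proof (rule eq_matI)
    fix r s assume "r < dim_row (X * transpose_mat X)" "s < dim_col (X * transpose_mat X)"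
    then have rs: "r < n" "s < n" using X by auto
    have "(\<Sum>m\<in>C. X $$ (r, m) * X $$ (s, m)) + (\<Sum>m\<in>?D. X $$ (r, m) * X $$ (s, m))
        = (\<Sum>m\<in>{0..<p}. X $$ (r, m) * X $$ (s, m))"
      using sum.subset_diff[OF C, of "\<lambda>m. X $$ (r, m) * X $$ (s, m)"] by simp
    then show "(cols_in X C * transpose_mat (cols_in X C) + cols_out X C * transpose_mat (cols_out X C))
        $$ (r, s) = (X * transpose_mat X) $$ (r, s)"
      using X rs cols_in_carrier[OF X C] cols_in_carrier[OF X D]
      by (simp add: cols_out_eq[OF X] outer[OF C rs] outer[OF D rs] scalar_prod_def del: index_mult_mat(1))
        (simp add: scalar_prod_def)
  qed (use X cols_in_carrier[OF X C] cols_in_carrier[OF X D] in \<open>auto simp: cols_out_eq[OF X]\<close>)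
qed

section \<open>Projection onto the tangent space of a block\<close>

text \<open>The usual closed formula, with the normal part \<open>(I - X X\<^sup>T) \<xi>\<close>
  expanded so that no matrix of size n by n occurs.\<close>

definition block_tangent_proj :: "nat set \<Rightarrow> real mat \<Rightarrow> real mat \<Rightarrow> real mat" where
  "block_tangent_proj C X \<xi> =
     (let Y = cols_in X C in
      Y * ((1 / 2) \<cdot>\<^sub>m (transpose_mat Y * \<xi> - transpose_mat \<xi> * Y)) + \<xi> - X * (transpose_mat X * \<xi>))"

text \<open>The closed formula gives a tangent matrix whose residual is orthogonal to every tangent
  matrix, so \<open>fro_proj_eqI\<close> applies. The computations rest on \<open>Y\<close> and
  \<open>W\<close> having orthonormal columns that are mutually orthogonal.\<close>

lemma fro_proj_block_tangent:
  assumes X: "X \<in> stiefel n p" and C: "C \<subseteq> {0..<p}" and \<xi>: "\<xi> \<in> carrier_mat n (card C)"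
  shows "fro_proj (block_tangent n p C X) \<xi> = block_tangent_proj C X \<xi>"
proof -
  let ?T = transpose_mat and ?D = "{0..<p} - C"
  define c d Y W where "c = card C" and "d = card ?D" and "Y = cols_in X C" and "W = cols_out X C"
  define U where "U = ?T Y * \<xi>"
  define V where "V = ?T W * \<xi>"
  define S where "S = (1 / 2 :: real) \<cdot>\<^sub>m (U - ?T U)"
  \<comment> \<open>\<open>H\<close> is the part of \<open>\<xi>\<close> in the column span of
    \<open>X\<close>, with coefficients \<open>U\<close> and \<open>V\<close>; it will equal
    \<open>X (X\<^sup>T \<xi>)\<close>.\<close>
  define H where "H = Y * U + W * V"
  define G where "G = Y * S + \<xi> - H"
  have cX: "X \<in> carrier_mat n p" using X by (simp add: stiefel_def)
  have D: "?D \<subseteq> {0..<p}" by auto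
  have cx [simp]: "\<xi> \<in> carrier_mat n c" using \<xi> by (simp add: c_def)
  have YW: "Y \<in> stiefel n c" "W \<in> stiefel n d"
    using cols_in_stiefel[OF X C] cols_in_stiefel[OF X D]
    by (simp_all add: Y_def W_def c_def d_def cols_out_eq[OF cX])
  then have cY [simp]: "Y \<in> carrier_mat n c" and cW [simp]: "W \<in> carrier_mat n d"
    and YY: "?T Y * Y = 1\<^sub>m c" and WW: "?T W * W = 1\<^sub>m d"
    by (auto simp: stiefel_def)
  have YW0: "?T Y * W = 0\<^sub>m c d" and WY0: "?T W * Y = 0\<^sub>m d c"
    using gram_cols_in_disjoint[OF X C D] gram_cols_in_disjoint[OF X D C]
    by (auto simp: Y_def W_def c_def d_def cols_out_eq[OF cX])
  have cU [simp]: "U \<in> carrier_mat c c" and cV [simp]: "V \<in> carrier_mat d c"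
    unfolding U_def V_def by (auto intro: mult_carrier_mat[where n = n])
  have cS [simp]: "S \<in> carrier_mat c c" by (simp add: S_def minus_carrier_mat)
  have cYS [simp]: "Y * S \<in> carrier_mat n c" and cYU [simp]: "Y * U \<in> carrier_mat n c"
    and cWV [simp]: "W * V \<in> carrier_mat n c"
    by (auto intro: mult_carrier_mat[OF cY] mult_carrier_mat[OF cW])
  have cH [simp]: "H \<in> carrier_mat n c" by (simp add: H_def)
  have cG [simp]: "G \<in> carrier_mat n c" by (simp add: G_def minus_carrier_mat)
  note [simp] = carrier_matD[OF cx] carrier_matD[OF cY] carrier_matD[OF cU] carrier_matD[OF cS]
    carrier_matD[OF cH] carrier_matD[OF cV]
  have H: "X * (?T X * \<xi>) = H"
  proof -
    have "X * (?T X * \<xi>) = (Y * ?T Y + W * ?T W) * \<xi>"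
      using cX cols_in_outer_sum[OF cX C] assoc_mult_mat[OF cX _ cx, of "?T X"]
      by (simp add: Y_def W_def)
    also have "\<dots> = Y * ?T Y * \<xi> + W * ?T W * \<xi>"
      by (rule add_mult_distrib_mat[where nr = n and n = n and nc = c])
        (auto intro: mult_carrier_mat[OF cY] mult_carrier_mat[OF cW])
    also have "\<dots> = H"
      unfolding H_def U_def V_def
      using assoc_mult_mat[OF cY _ cx, of "?T Y"] assoc_mult_mat[OF cW _ cx, of "?T W"] by simp
    finally show ?thesis .
  qed
  have TU: "?T U = ?T \<xi> * Y"
    unfolding U_def by (subst transpose_mult[where nr = c and n = n and nc = c]) auto
  have G: "block_tangent_proj C X \<xi> = G"
    unfolding block_tangent_proj_def Let_def Y_def[symmetric] G_def S_def TU H by (simp add: U_def)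
  have blk: "Z \<in> block_tangent n p C X \<longleftrightarrow> Z \<in> carrier_mat n c \<and>
      ?T Z * Y + ?T Y * Z = 0\<^sub>m c c \<and> ?T W * Z = 0\<^sub>m d c" for Z
    by (simp add: block_tangent_def Y_def W_def c_def d_def)
  have cTY: "?T Y \<in> carrier_mat c n" and cTW: "?T W \<in> carrier_mat d n" by simp_all
  have YYm: "?T Y * (Y * M) = M" and WYm: "?T W * (Y * M) = 0\<^sub>m d c"
    if M: "M \<in> carrier_mat c c" for M
    unfolding assoc_mult_mat[OF cTY cY M, symmetric] assoc_mult_mat[OF cTW cY M, symmetric] YY WY0
    by (rule left_mult_one_mat[OF M], rule left_mult_zero_mat[OF M])
  have WWm: "?T W * (W * M) = M" and YWm: "?T Y * (W * M) = 0\<^sub>m c c"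
    if M: "M \<in> carrier_mat d c" for M
    unfolding assoc_mult_mat[OF cTY cW M, symmetric] assoc_mult_mat[OF cTW cW M, symmetric] WW YW0
    by (rule left_mult_one_mat[OF M], rule left_mult_zero_mat[OF M])
  have TYH: "?T Y * H = U" and TWH: "?T W * H = V"
  proof -
    have "?T Y * H = ?T Y * (Y * U) + ?T Y * (W * V)"
      unfolding H_def by (rule mult_add_distrib_mat[where nr = c and n = n and nc = c]) auto
    also have "\<dots> = U"
      by (simp add: YYm YWm)
    finally show "?T Y * H = U" .
    have "?T W * H = ?T W * (Y * U) + ?T W * (W * V)"
      unfolding H_def by (rule mult_add_distrib_mat[where nr = d and n = n and nc = c]) auto
    also have "\<dots> = V"
      by (simp add: WYm WWm)
    finally show "?T W * H = V" .
  qed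
  \<comment> \<open>\<open>\<xi>\<close> and \<open>H\<close> have the same image under
    \<open>Y\<^sup>T\<close>, so only the contribution of \<open>Y * S\<close> survives; likewise
    for \<open>W\<^sup>T\<close> below, where that contribution is zero.\<close>
  have TYG: "?T Y * G = S"
  proof -
    have "?T Y * G = ?T Y * (Y * S) + U - U"
      unfolding G_def TYH[symmetric] by (subst mult_minus_distrib_mat[where nr = c and n = n and nc = c], simp_all)
        (subst mult_add_distrib_mat[where nr = c and n = n and nc = c], simp_all add: TYH U_def)
    also have "?T Y * (Y * S) = S"
      by (simp add: YYm)
    finally show ?thesis by (auto intro!: eq_matI)
  qed
  have TWG: "?T W * G = 0\<^sub>m d c"
  proof -
    have "?T W * G = ?T W * (Y * S) + V - V"
      unfolding G_def by (subst mult_minus_distrib_mat[where nr = d and n = n and nc = c], simp_all)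
        (subst mult_add_distrib_mat[where nr = d and n = n and nc = c], simp_all add: TWH V_def)
    also have "?T W * (Y * S) = 0\<^sub>m d c"
      by (simp add: WYm)
    finally show ?thesis by (auto intro!: eq_matI)
  qed
  \<comment> \<open>The first tangency condition thereby becomes \<open>S\<^sup>T + S = 0\<close>,
    true because \<open>S\<close> is the skew part of \<open>U\<close>.\<close>
  have "?T G * Y = ?T S"
    unfolding TYG[symmetric] by (subst transpose_mult[where nr = c and n = n and nc = c]) auto
  then have "?T G * Y + ?T Y * G = 0\<^sub>m c c"
    unfolding TYG by (auto intro!: eq_matI simp: S_def field_simps)
  then have Gin: "G \<in> block_tangent n p C X"
    by (simp add: blk TWG)
  text \<open>The residual is \<open>Y P + W V\<close> with \<open>P\<close> symmetric, whereas \<open>Y\<^sup>T Z\<close> is skew and \<open>W\<^sup>T Z = 0\<close>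
    for tangent \<open>Z\<close>.\<close>
  have orth: "fro_inner (\<xi> - G) Z = 0" if Z: "Z \<in> block_tangent n p C X" for Z
  proof -
    have cZ [simp]: "Z \<in> carrier_mat n c" and Zskew: "?T Z * Y + ?T Y * Z = 0\<^sub>m c c"
      and Zout: "?T W * Z = 0\<^sub>m d c"
      using Z by (auto simp: blk)
    have res: "\<xi> - G = H - Y * S"
      unfolding G_def by (auto intro!: eq_matI simp del: index_mult_mat(1))
    have cTYZ: "?T Y * Z \<in> carrier_mat c c" by (rule mult_carrier_mat[where n = n]) auto
    \<comment> \<open>\<open>U - S\<close> is half of \<open>U + U\<^sup>T\<close>, the symmetric
      part of \<open>U\<close>.\<close>
    have sym: "fro_inner (U - S) (?T Y * Z) = 0"
    proof (rule fro_inner_symmetric_skew[OF _ cTYZ])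
      show "U - S \<in> carrier_mat c c" by (simp add: minus_carrier_mat)
      show "?T (U - S) = U - S"
        by (auto intro!: eq_matI simp: S_def field_simps)
      have "?T (?T Y * Z) = ?T Z * Y" by (subst transpose_mult[where nr = c and n = n and nc = c]) auto
      then show "?T (?T Y * Z) + ?T Y * Z = 0\<^sub>m c c" using Zskew by simp
    qed
    have "fro_inner (\<xi> - G) Z = fro_inner (Y * U) Z + fro_inner (W * V) Z - fro_inner (Y * S) Z"
      unfolding res H_def by (simp add: fro_inner_diff_left[where n = n and q = c]
          fro_inner_add_left[where n = n and q = c])
    also have "\<dots> = fro_inner U (?T Y * Z) + fro_inner V (?T W * Z) - fro_inner S (?T Y * Z)"
      by (simp add: fro_inner_mult_left[OF cY _ cZ] fro_inner_mult_left[OF cW _ cZ])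
    also have "\<dots> = fro_inner (U - S) (?T Y * Z)"
      by (simp add: Zout fro_inner_zero_right fro_inner_diff_left[where n = c and q = c])
    finally show ?thesis using sym by simp
  qed
  show ?thesis unfolding G
  proof (rule fro_proj_eqI[where n = n and q = c])
    show "block_tangent n p C X \<subseteq> carrier_mat n c" by (auto simp: blk)
    fix Z assume Z: "Z \<in> block_tangent n p C X"
    then have "Z \<in> carrier_mat n c" by (simp add: blk)
    \<comment> \<open>Both \<open>G\<close> and \<open>Z\<close> are tangent, so the residual is
      orthogonal to each of them and hence to the difference.\<close>
    then show "fro_inner (\<xi> - G) (G - Z) = 0"
      using orth[OF Z] orth[OF Gin]
      by (simp add: fro_inner_diff_right[where n = n and q = c] minus_carrier_mat)
  qed (use Gin in simp_all)
qed

section \<open>The iteration as a matrix computation\<close>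

text \<open>The bracketing \<open>X (X\<^sup>T \<xi>)\<close> matters: forming \<open>X X\<^sup>T\<close> first would cost \<open>n\<^sup>2 p\<close> operations.\<close>

definition tangent_prog :: mexp where
  "tangent_prog =
     Sub (Add
           (Mul (GetCols Iterate)
             (Scale (Const (1 / 2))
               (Sub (Mul (Transp (GetCols Iterate)) Subgrad) (Mul (Transp Subgrad) (GetCols Iterate)))))
           Subgrad)
         (Mul Iterate (Mul (Transp Iterate) Subgrad))"

definition rssm_prog :: mexp where
  "rssm_prog =
     PutCols Iterate (ProjStiefel (Sub (GetCols Iterate) (Scale Stepsize tangent_prog)))"

text \<open>The program evaluates the closed formula, whereas \<open>rssm_step\<close> asks for the
  nearest point in the tangent space; \<open>fro_proj_block_tangent\<close> identifies the
  two.\<close>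

lemma rssm_prog_correct:
  fixes \<gamma> :: real
  assumes X: "X \<in> stiefel n p" and C: "C \<subseteq> {0..<p}" and \<xi>: "\<xi> \<in> carrier_mat n (card C)"
    and pn: "p \<le> n"
  defines "s \<equiv> \<lparr>iterate = X, subgrad = \<xi>, stepsize = \<gamma>, block = C\<rparr>"
  shows "well_dim s rssm_prog" "rssm_step n p C \<gamma> X \<xi> (run s rssm_prog)"
proof -
  have cX: "X \<in> carrier_mat n p" using X by (simp add: stiefel_def)
  note cY = cols_in_carrier[OF cX C]
  define A where "A = cols_in X C - \<gamma> \<cdot>\<^sub>m block_tangent_proj C X \<xi>"
  define P where "P = fro_proj (stiefel n (card C)) A"
  have "block_tangent_proj C X \<xi> \<in> carrier_mat n (card C)"
    using cX \<xi> unfolding block_tangent_proj_def Let_def by (intro minus_carrier_mat) simp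
  then have cA: "A \<in> carrier_mat n (card C)"
    by (simp add: A_def minus_carrier_mat)
  \<comment> \<open>The manifold is nonempty since it contains the current block. Existence of a
    nearest point is what gives the chosen matrix \<open>P\<close> the right dimensions for
    insertion.\<close>
  have "P \<in> stiefel n (card C)"
    unfolding P_def using cols_in_stiefel[OF X C] by (intro fro_proj_stiefel[OF cA]) blast
  then have cP: "P \<in> carrier_mat n (card C)" by (simp add: stiefel_def)
  have tang: "run s tangent_prog = block_tangent_proj C X \<xi>"
    by (simp add: tangent_prog_def s_def block_tangent_proj_def Let_def)
  have inner: "run s (Sub (GetCols Iterate) (Scale Stepsize tangent_prog)) = A"
    by (simp add: tang) (simp add: A_def s_def)
  have proj: "run s (ProjStiefel (Sub (GetCols Iterate) (Scale Stepsize tangent_prog))) = P"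
    unfolding run.simps(10) inner using cA by (simp add: P_def)
  have run: "run s rssm_prog = set_cols X C P"
    unfolding rssm_prog_def run.simps(9) proj by (simp add: s_def)
  show "rssm_step n p C \<gamma> X \<xi> (run s rssm_prog)"
    unfolding run rssm_step_def Let_def fro_proj_block_tangent[OF X C \<xi>]
    using set_cols_carrier[OF cX] cols_in_set_cols[OF cX C cP] cols_out_set_cols[OF cX C]
    by (simp add: P_def A_def)
  have "card C \<le> p" using card_mono[OF _ C] by simp
  moreover have "well_dim s tangent_prog"
    using cX cY \<xi> C by (auto simp: tangent_prog_def s_def)
  ultimately show "well_dim s rssm_prog"
    unfolding rssm_prog_def well_dim.simps proj inner
    using cX cY cP cA \<xi> C pn tang \<open>block_tangent_proj C X \<xi> \<in> carrier_mat n (card C)\<close>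
    by (simp add: s_def) 
qed

section \<open>Operation count\<close>

text \<open>The constant 20 counts operations, repeated subexpressions included: 8 rearrangements, 5
  products, 6 entrywise operations and 1 projection. Since \<open>1 \<le> c \<le> p \<le> n\<close>
  for \<open>c = card C\<close>, each costs at most \<open>\<kappa> * n * p * c\<close>.\<close>

lemma rssm_prog_flops:
  fixes \<gamma> :: real
  assumes X: "X \<in> carrier_mat n p" and C: "C \<subseteq> {0..<p}" "C \<noteq> {}" and \<xi>: "\<xi> \<in> carrier_mat n (card C)"
    and pn: "p \<le> n" and T: "cost_convention \<kappa> T" and \<kappa>: "0 \<le> \<kappa>"
  defines "s \<equiv> \<lparr>iterate = X, subgrad = \<xi>, stepsize = \<gamma>, block = C\<rparr>"
  shows "real (flops T s rssm_prog) \<le> 20 * \<kappa> * real (n * p * card C)"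
proof -
  define c where "c = card C"
  let ?N = "n * p * c"
  have cp: "c \<le> p" using card_mono[OF _ C(1)] by (simp add: c_def)
  have c1: "1 \<le> c" using C finite_subset[OF C(1)] by (simp add: c_def Suc_le_eq card_gt_0_iff)
  have bnd: "x \<le> \<kappa> * real ?N" if "x \<le> \<kappa> * real m" "m \<le> ?N" for x m
    using that \<kappa> by (meson mult_left_mono of_nat_mono order_trans)
  have mul: "real (mul_ops T a b e) \<le> \<kappa> * real ?N" if "a * b * e \<le> ?N" for a b e
    using T that by (intro bnd[of _ "a * b * e"]) (auto simp: cost_convention_def)
  have ent: "real (ent_ops T a b) \<le> \<kappa> * real ?N" if "a * b \<le> ?N" for a b
    using T that by (intro bnd[of _ "a * b"]) (auto simp: cost_convention_def)
  have move: "real (move_ops T a b) \<le> \<kappa> * real ?N" if "a * b \<le> ?N" for a b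
    using T that by (intro bnd[of _ "a * b"]) (auto simp: cost_convention_def)
  have proj: "real (proj_ops T n c) \<le> \<kappa> * real ?N"
    using T cp pn by (intro bnd[of _ "n * c\<^sup>2"]) (auto simp: cost_convention_def power2_eq_square)
  \<comment> \<open>Transposing \<open>X\<close> and inserting the new columns touch all
    \<open>n * p\<close> entries; a nonempty block is what makes this fit the bound.\<close>
  have np: "n * p \<le> ?N" using c1 by simp
  have pc: "p * c \<le> ?N" using c1 cp pn by simp
  have nc: "n * c \<le> ?N" using c1 cp by simp
  have ncc: "n * c * c \<le> ?N" using cp by simp
  have cc: "c * c \<le> ?N" using mult_le_mono1[OF cp, of c] pc by linarith
  have dims: "dim_row X = n" "dim_col X = p" "dim_row \<xi> = n" "dim_col \<xi> = c"
    "dim_row (cols_in X C) = n" "dim_col (cols_in X C) = c"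
    using X \<xi> cols_in_carrier[OF X C(1)] by (auto simp: c_def)
  have "real (flops T s rssm_prog) =
      4 * real (move_ops T n c) + real (move_ops T c n) + real (move_ops T c n) + real (move_ops T p n)
      + real (move_ops T n p)
      + real (mul_ops T c n c) + real (mul_ops T c n c) + real (mul_ops T n c c)
      + real (mul_ops T p n c) + real (mul_ops T n p c)
      + 2 * real (ent_ops T c c) + 4 * real (ent_ops T n c) + real (proj_ops T n c)"
    by (simp add: rssm_prog_def tangent_prog_def s_def dims flip: c_def)
  also have "\<dots> \<le> 20 * (\<kappa> * real ?N)"
    using move[OF nc] move[of c n] move[of p n] move[OF np] mul[of c n c] mul[of n c c] mul[of p n c]
      mul[of n p c] ent[OF cc] ent[OF nc] proj np nc ncc
    by (simp add: mult.commute mult.left_commute)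
  finally show ?thesis by (simp add: c_def mult.assoc)
qed

section \<open>Block sizes and the bound for one iteration\<close>

theorem proposition3p5:
  shows "\<exists>prog :: mexp. \<forall>\<kappa>>0. \<exists>K>0. \<forall>T. cost_convention \<kappa> T \<longrightarrow>
    (\<forall>(n::nat) (p::nat) (l::nat) (C :: nat \<Rightarrow> nat set) (i::nat) (j::nat)
       (L::real) (f :: real mat \<Rightarrow> real) (\<gamma>::real) (X :: real mat) (\<xi> :: real mat).
       1 \<le> p \<and> p \<le> n \<and>
       2 \<le> l \<and> partition_on {0..<p} (C ` {1..l}) \<and> inj_on C {1..l} \<and>
       (\<forall>k\<in>{1..l}. int (card (C k)) \<le> \<lceil>real p / real l\<rceil>) \<and>
       i \<in> {1..l} \<and> j \<in> {1..l} \<and> i \<noteq> j \<and>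
       0 < L \<and> rssm_objective n p L f \<and> 0 < \<gamma> \<and> \<gamma> < 1 / L \<and>
       X \<in> stiefel n p \<and> \<xi> \<in> partial_clarke_subdiff n (C i \<union> C j) f X \<longrightarrow>
       (let s = \<lparr>iterate = X, subgrad = \<xi>, stepsize = \<gamma>, block = C i \<union> C j\<rparr> in
          well_dim s prog \<and>
          rssm_step n p (C i \<union> C j) \<gamma> X \<xi> (run s prog) \<and>
          real (flops T s prog) \<le> K * (real n * (real p)\<^sup>2 / real l)))"
proof (intro exI[of _ rssm_prog] allI impI)
  fix \<kappa> :: real assume \<kappa>: "0 < \<kappa>"
  show "\<exists>K>0. \<forall>T. cost_convention \<kappa> T \<longrightarrow>
    (\<forall>(n::nat) (p::nat) (l::nat) (C :: nat \<Rightarrow> nat set) (i::nat) (j::nat)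
       (L::real) (f :: real mat \<Rightarrow> real) (\<gamma>::real) (X :: real mat) (\<xi> :: real mat).
       1 \<le> p \<and> p \<le> n \<and>
       2 \<le> l \<and> partition_on {0..<p} (C ` {1..l}) \<and> inj_on C {1..l} \<and>
       (\<forall>k\<in>{1..l}. int (card (C k)) \<le> \<lceil>real p / real l\<rceil>) \<and>
       i \<in> {1..l} \<and> j \<in> {1..l} \<and> i \<noteq> j \<and>
       0 < L \<and> rssm_objective n p L f \<and> 0 < \<gamma> \<and> \<gamma> < 1 / L \<and>
       X \<in> stiefel n p \<and> \<xi> \<in> partial_clarke_subdiff n (C i \<union> C j) f X \<longrightarrow>
       (let s = \<lparr>iterate = X, subgrad = \<xi>, stepsize = \<gamma>, block = C i \<union> C j\<rparr> in
          well_dim s rssm_prog \<and>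
          rssm_step n p (C i \<union> C j) \<gamma> X \<xi> (run s rssm_prog) \<and>
          real (flops T s rssm_prog) \<le> K * (real n * (real p)\<^sup>2 / real l)))"
  \<comment> \<open>80 is 20 operations times 4, the latter from two blocks of at most
    \<open>2 * p / l\<close> columns each.\<close>
  proof (intro exI[of _ "80 * \<kappa>"] conjI allI impI, goal_cases)
    case 1
    then show ?case using \<kappa> by simp
  next
    case (2 T n p l C i j L f \<gamma> X \<xi>)
    then have pn: "p \<le> n" and l: "2 \<le> l" and part: "partition_on {0..<p} (C ` {1..l})"
      and inj: "inj_on C {1..l}" and size: "\<forall>k\<in>{1..l}. int (card (C k)) \<le> \<lceil>real p / real l\<rceil>"
      and ij: "i \<in> {1..l}" "j \<in> {1..l}" and X: "X \<in> stiefel n p"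
      and sub: "\<xi> \<in> partial_clarke_subdiff n (C i \<union> C j) f X"
      and T: "cost_convention \<kappa> T"
      by auto
    let ?B = "C i \<union> C j"
    have B: "?B \<subseteq> {0..<p}" "?B \<noteq> {}"
      using part ij unfolding partition_on_def by blast+
    have \<xi>: "\<xi> \<in> carrier_mat n (card ?B)"
      using sub by (simp add: partial_clarke_subdiff_def clarke_subdiff_def)
    have cX: "X \<in> carrier_mat n p" using X by (simp add: stiefel_def)
    have lp: "l \<le> p"
    proof -
      \<comment> \<open>Injectivity of \<open>C\<close> ensures that the partition has exactly
        \<open>l\<close> classes; each has at least one element, and their sizes add up to
        \<open>p\<close>.\<close>
      have "l = (\<Sum>k\<in>C ` {1..l}. 1)" using card_image[OF inj] by simp
      also have "\<dots> \<le> (\<Sum>k\<in>C ` {1..l}. card k)"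
        using partition_onD1[OF part] partition_onD3[OF part]
        by (intro sum_mono) (metis One_nat_def Suc_leI Union_upper card_gt_0_iff finite_atLeastLessThan finite_subset)
      also have "\<dots> = p"
        using product_partition[OF part] partition_onD1[OF part]
        by (metis Union_upper card_atLeastLessThan diff_zero finite_atLeastLessThan finite_subset)
      finally show ?thesis .
    qed
    have block: "real (card (C k)) \<le> 2 * (real p / real l)" if "k \<in> {1..l}" for k
    proof -
      have "real (card (C k)) \<le> real_of_int \<lceil>real p / real l\<rceil>"
        using size that by (metis of_int_le_iff of_int_of_nat_eq)
      also have "\<dots> \<le> real p / real l + 1" by linarith
      also have "1 \<le> real p / real l" using lp l by simp
      finally show ?thesis by simp
    qed
    have card: "real (card ?B) \<le> 4 * (real p / real l)"
      using block[OF ij(1)] block[OF ij(2)] card_Un_le[of "C i" "C j"] by linarith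
    have "20 * \<kappa> * real (n * p * card ?B) = 20 * \<kappa> * (real n * real p) * real (card ?B)"
      by simp
    also have "\<dots> \<le> 20 * \<kappa> * (real n * real p) * (4 * (real p / real l))"
      using \<kappa> card by (intro mult_left_mono) auto
    also have "\<dots> = 80 * \<kappa> * (real n * (real p)\<^sup>2 / real l)"
      by (simp add: power2_eq_square)
    finally have "20 * \<kappa> * real (n * p * card ?B) \<le> 80 * \<kappa> * (real n * (real p)\<^sup>2 / real l)" .
    moreover note rssm_prog_flops[OF cX B \<xi> pn T less_imp_le[OF \<kappa>], of \<gamma>]
    ultimately show ?case
      using rssm_prog_correct[OF X B(1) \<xi> pn, of \<gamma>] unfolding Let_def by linarith
  qed
qed

end
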